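(* Let $n\ge1$ be an integer, let $c$ be a constant and let $H_{n;c}(x)=H_n(x)+c\,H_{n-1}(x)$. Then \[ \operatorname{disc}(H_{n;c})=2^{n(3n-5)/2}\prod_{k=1}^{n-1}k^k\cdot(-c)^nH_{n;c}\!\left(-\frac{c^2+2n}{2c}\right). \] Furthermore, $\operatorname{disc}(H_{n;c})$ is an even polynomial in $c$ of degree $2(n-1)$.
   Context: $H_n$ is the $n$-th (physicists') Hermite polynomial, $H_n(x)=(-1)^ne^{x^2}\frac{d^n}{dx^n}e^{-x^2}=\sum_{k=0}^{\lfloor n/2\rfloor}(-1)^k\frac{n!}{k!(n-2k)!}(2x)^{n-2k}$. Constants are real or complex numbers. For $f=a_0\prod_{i=1}^n(x-\alpha_i)$ of degree $n$, $\operatorname{disc}(f)=a_0^{2n-2}\prod_{1\le i<j\le n}(\alpha_i-\alpha_j)^2$. The factor $(-c)^nH_{n;c}(-(c^2+2n)/(2c))$ is a polynomial in $c$; at $c=0$ it denotes the value of that polynomial. *)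

theory Defs
  imports
    "HOL-Analysis.Analysis"
    "HOL-Computational_Algebra.Polynomial"
    "HOL-Combinatorics.Permutations"
begin

definition hermite :: "nat \<Rightarrow> complex poly" where
  "hermite n = (\<Sum>k\<le>n div 2.
     smult ((- 1) ^ k * (fact n / (fact k * fact (n - 2 * k)))) ([:0, 2:] ^ (n - 2 * k)))"

(* H_{n;c} = H_n + c H_{n-1}; only meant for n >= 1. *)
definition hermite_quasi :: "nat \<Rightarrow> complex \<Rightarrow> complex poly" where
  "hermite_quasi n c = hermite n + smult c (hermite (n - 1))"

definition root_diff_prod :: "complex list \<Rightarrow> complex" where
  "root_diff_prod xs =
     (\<Prod>(i, j)\<in>{(i, j). i < j \<and> j < length xs}. (xs ! i - xs ! j)\<^sup>2)"

(* The roots are listed with multiplicity; disc_eq below shows that the value does not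
   depend on the listing. *)
definition disc :: "complex poly \<Rightarrow> complex" where
  "disc f = lead_coeff f ^ (2 * degree f - 2) *
     root_diff_prod (SOME xs. f = smult (lead_coeff f) (\<Prod>x\<leftarrow>xs. [:- x, 1:]))"

lemma root_diff_prod_permute:
  assumes "mset xs = mset ys"
  shows "root_diff_prod xs = root_diff_prod ys"
proof -
  define n where "n = length ys"
  have len: "length xs = n" using assms n_def mset_eq_length by blast
  obtain p where p: "p permutes {..<n}" "permute_list p ys = xs"
    using mset_eq_permutation[OF assms] n_def by metis
  have nth: "xs ! i = ys ! p i" if "i < n" for i
    using permute_list_nth[of p ys i] p that n_def by simp
  define U where "U = {(i, j). i < j \<and> j < n}"
  define h where "h = (\<lambda>(i, j). (min (p i) (p j), max (p i) (p j)))"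
  define q where "q = inv p"
  define g where "g = (\<lambda>(i, j). (min (q i) (q j), max (q i) (q j)))"
  have q: "q permutes {..<n}" unfolding q_def using p(1) by (rule permutes_inv)
  have pq: "p (q i) = i" "q (p i) = i" for i
    unfolding q_def using permutes_inverses[OF p(1)] by auto
  have pn: "p i < n \<longleftrightarrow> i < n" for i using permutes_in_image[OF p(1), of i] by simp
  have qn: "q i < n \<longleftrightarrow> i < n" for i using permutes_in_image[OF q, of i] by simp
  have pinj: "p i = p j \<longleftrightarrow> i = j" for i j by (metis pq(2))
  have qinj: "q i = q j \<longleftrightarrow> i = j" for i j by (metis pq(1))
  have "(\<Prod>(i, j)\<in>U. (ys ! p i - ys ! p j)\<^sup>2) = (\<Prod>(i, j)\<in>U. (ys ! i - ys ! j)\<^sup>2)"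
  proof (rule prod.reindex_bij_witness[where i = g and j = h])
    fix a assume a: "a \<in> U"
    obtain i j where ij: "a = (i, j)" "i < j" "j < n" using a by (auto simp: U_def)
    have ne: "p i \<noteq> p j" "q i \<noteq> q j" using ij pinj qinj by auto
    show "g (h a) = a" using ij ne by (auto simp: g_def h_def min_def max_def pq)
    show "h (g a) = a" using ij ne by (auto simp: g_def h_def min_def max_def pq)
    have b: "p i < n" "p j < n" "q i < n" "q j < n" using ij pn qn by auto
    show "h a \<in> U" using ij b ne by (auto simp: h_def U_def min_def max_def)
    show "g a \<in> U" using ij b ne by (auto simp: g_def U_def min_def max_def)
    show "(case h a of (i, j) \<Rightarrow> (ys ! i - ys ! j)\<^sup>2) = (case a of (i, j) \<Rightarrow> (ys ! p i - ys ! p j)\<^sup>2)"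
      using ij by (auto simp: h_def min_def max_def power2_commute)
  qed
  moreover have "(\<Prod>(i, j)\<in>U. (xs ! i - xs ! j)\<^sup>2) = (\<Prod>(i, j)\<in>U. (ys ! p i - ys ! p j)\<^sup>2)"
    by (rule prod.cong) (auto simp: U_def nth)
  ultimately show ?thesis
    unfolding root_diff_prod_def len n_def[symmetric] U_def by simp
qed

lemma proots_prod_linear: "proots (\<Prod>x\<leftarrow>xs. [:- x, 1:]) = mset (xs :: complex list)"
proof (induction xs)
  case (Cons a xs)
  have "(\<Prod>x\<leftarrow>xs. [:- x, 1:]) \<noteq> 0" by (auto simp: prod_list_zero_iff)
  then show ?case
    using Cons proots_mult[of "[:- a, 1:]" "\<Prod>x\<leftarrow>xs. [:- x, 1:]"] by simp
qed simp

lemma degree_lead_coeff_prod_linear: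
  "degree (\<Prod>x\<leftarrow>xs. [:- x, 1:]) = length (xs :: complex list)
   \<and> lead_coeff (\<Prod>x\<leftarrow>xs. [:- x, 1:]) = 1"
proof (induction xs)
  case (Cons a xs)
  have "(\<Prod>x\<leftarrow>xs. [:- x, 1:]) \<noteq> 0" by (auto simp: prod_list_zero_iff)
  then have "degree ([:- a, 1:] * (\<Prod>x\<leftarrow>xs. [:- x, 1:])) = Suc (length xs)"
    using Cons by (subst degree_mult_eq) auto
  moreover have "lead_coeff ([:- a, 1:] * (\<Prod>x\<leftarrow>xs. [:- x, 1:])) = 1"
    unfolding lead_coeff_mult using conjunct2[OF Cons] by simp
  ultimately show ?case by (simp only: list.map prod_list.Cons list.size) simp
qed simp

lemma disc_eq:
  assumes "a \<noteq> 0" and "f = smult a (\<Prod>x\<leftarrow>xs. [:- x, 1:])"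
  shows "disc f = a ^ (2 * length xs - 2) *
           (\<Prod>(i, j)\<in>{(i, j). i < j \<and> j < length xs}. (xs ! i - xs ! j)\<^sup>2)"
proof -
  have lc: "lead_coeff f = a" and dg: "degree f = length xs"
    using assms degree_lead_coeff_prod_linear[of xs] by auto
  define ys where "ys = (SOME xs. f = smult (lead_coeff f) (\<Prod>x\<leftarrow>xs. [:- x, 1:]))"
  have "f = smult (lead_coeff f) (\<Prod>x\<leftarrow>ys. [:- x, 1:])"
    unfolding ys_def by (rule someI[of _ xs]) (simp add: lc assms(2)[symmetric])
  then have "mset xs = mset ys"
    using assms lc proots_prod_linear proots_smult by metis
  then have "root_diff_prod ys = root_diff_prod xs"
    using root_diff_prod_permute by metis
  then show ?thesis
    using lc unfolding disc_def ys_def[symmetric] by (simp add: root_diff_prod_def dg lc[unfolded dg])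
qed

lemma coeff_hermite:
  "coeff (hermite n) m =
     (if m \<le> n \<and> even (n - m)
      then (- 1) ^ ((n - m) div 2) * fact n * 2 ^ m / (fact ((n - m) div 2) * fact m) else 0)"
proof -
  have mon: "[:0, 2:] ^ j = monom ((2::complex) ^ j) j" for j
    by (induction j) (simp_all add: monom_Suc mult.commute smult_monom)
  have "coeff (hermite n) m = (\<Sum>k\<le>n div 2. if k = (n - m) div 2 \<and> m \<le> n \<and> even (n - m)
      then (- 1) ^ ((n - m) div 2) * fact n * 2 ^ m / (fact ((n - m) div 2) * fact m) else 0)"
    unfolding hermite_def mon coeff_sum smult_monom coeff_monom
  proof (rule sum.cong[OF refl])
    fix k assume "k \<in> {..n div 2}"
    then have k: "2 * k \<le> n" by auto
    have e: "n - 2 * k = m \<longleftrightarrow> k = (n - m) div 2 \<and> m \<le> n \<and> even (n - m)"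
      using k by presburger
    show "(if n - 2 * k = m
        then (- 1) ^ k * (fact n / (fact k * fact (n - 2 * k))) * 2 ^ (n - 2 * k) else 0) =
      (if k = (n - m) div 2 \<and> m \<le> n \<and> even (n - m)
       then (- 1) ^ ((n - m) div 2) * fact n * 2 ^ m / (fact ((n - m) div 2) * fact m)
       else (0::complex))"
      unfolding e[symmetric] using e by auto
  qed
  also have "\<dots> = (if m \<le> n \<and> even (n - m)
      then (- 1) ^ ((n - m) div 2) * fact n * 2 ^ m / (fact ((n - m) div 2) * fact m) else 0)"
  proof (cases "m \<le> n \<and> even (n - m)")
    case True then show ?thesis by (simp add: sum.delta div_le_mono)
  next
    case False then show ?thesis by (simp only: simp_thms if_False sum.neutral_const)
  qed
  finally show ?thesis .
qed

lemma hermite_Suc: "hermite (Suc n) = [:0, 2:] * hermite n - pderiv (hermite n)"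
proof (rule poly_eqI)
  fix m
  have c: "coeff (pCons 0 (smult 2 (hermite n))) m = (case m of 0 \<Rightarrow> 0 | Suc l \<Rightarrow> 2 * coeff (hermite n) l)"
    by (cases m) simp_all
  consider "m = Suc n" | "m > Suc n" | "m \<le> n" "even (n - m)"
    | k where "n = m + (2 * k + 1)"
    by (metis Suc_eq_plus1 le_add_diff_inverse less_Suc_eq_le linorder_neqE_nat oddE)
  then show "coeff (hermite (Suc n)) m = coeff ([:0, 2:] * hermite n - pderiv (hermite n)) m"
  proof cases
    case 1 then show ?thesis
      by (simp add: c coeff_pderiv coeff_hermite del: fact_Suc)
  next
    case 2 then show ?thesis
      by (simp add: c coeff_pderiv coeff_hermite split: nat.split)
  next
    case 3 then show ?thesis
      by (auto simp: c coeff_pderiv coeff_hermite Suc_diff_le split: nat.split)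
  next
    case (4 k)
    have d: "Suc n - m = 2 * Suc k" "n - Suc m = 2 * k" "m \<le> n" "Suc m \<le> n" using 4 by auto
    show ?thesis
    proof (cases m)
      case 0
      have "n = 2 * k + 1" using 4 0 by simp
      then show ?thesis using d
        by (simp add: c coeff_pderiv coeff_hermite 0 field_simps del: of_nat_Suc)
           (simp add: algebra_simps)
    next
      case (Suc l)
      have e: "n - l = 2 * Suc k" "l \<le> n" using 4 Suc by auto
      have nn: "of_nat (Suc n) = (2 * of_nat (Suc k) + of_nat (Suc l) :: complex)"
        using 4 Suc by simp
      have nz: "of_nat (Suc k) \<noteq> (0::complex)" "of_nat (Suc l) \<noteq> (0::complex)"
        "of_nat (Suc m) \<noteq> (0::complex)"
        by (simp_all del: of_nat_Suc)
      show ?thesis using d e nz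
        apply (simp add: c coeff_pderiv coeff_hermite Suc del: of_nat_Suc)
        apply (simp only: nn)
        apply (simp add: divide_simps del: of_nat_Suc)
        apply (simp add: algebra_simps del: of_nat_Suc)
        done
    qed
  qed
qed

(* Rodrigues' formula. *)
lemma hermite_rodrigues:
  "poly (hermite n) x = (- 1) ^ n * exp (x\<^sup>2) * (deriv ^^ n) (\<lambda>z. exp (- z\<^sup>2)) x"
proof -
  have "(deriv ^^ n) (\<lambda>z. exp (- z\<^sup>2)) = (\<lambda>z::complex. (- 1) ^ n * exp (- z\<^sup>2) * poly (hermite n) z)"
  proof (induction n)
    case 0 show ?case by (simp add: hermite_def)
  next
    case (Suc n)
    have "deriv (\<lambda>z. (- 1) ^ n * exp (- z\<^sup>2) * poly (hermite n) z) z
        = (- 1) ^ Suc n * exp (- z\<^sup>2) * poly (hermite (Suc n)) z" for z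
      by (rule DERIV_imp_deriv)
         (auto intro!: derivative_eq_intros simp: hermite_Suc algebra_simps)
    then show ?case by (simp add: Suc)
  qed
  moreover have "exp (x\<^sup>2) * exp (- x\<^sup>2) = 1"
    by (rule exp_minus_inverse)
  moreover have "(- 1) ^ n * (- 1) ^ n = (1 :: complex)"
    by (rule minus_one_mult_self)
  ultimately have "(- 1) ^ n * exp (x\<^sup>2) * (deriv ^^ n) (\<lambda>z. exp (- z\<^sup>2)) x
      = ((- 1) ^ n * (- 1) ^ n) * (exp (x\<^sup>2) * exp (- x\<^sup>2)) * poly (hermite n) x"
    by (simp only: mult_ac)
  also have "\<dots> = poly (hermite n) x"
    by (simp only: exp_minus_inverse minus_one_mult_self mult_1)
  finally show ?thesis ..
qed

end

theory Submission
  imports Defs "HOL-Computational_Algebra.Fundamental_Theorem_Algebra"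
begin

text \<open>
  Write \<open>f = H\<^sub>n + c H\<^sub>n\<^sub>-\<^sub>1\<close> and let \<open>r\<close> run over its roots. Up to sign and a power of
  the leading coefficient \<open>2\<^sup>n\<close>, the discriminant is the product of the values \<open>f'(r)\<close>
  (\<open>disc_eq_prod_pderiv\<close>). The relations \<open>H\<^sub>m' = 2m H\<^sub>m\<^sub>-\<^sub>1\<close> and
  \<open>H\<^sub>m\<^sub>+\<^sub>1 = 2x H\<^sub>m - 2m H\<^sub>m\<^sub>-\<^sub>1\<close> express \<open>f'\<close> through \<open>H\<^sub>n\<close> and \<open>H\<^sub>n\<^sub>-\<^sub>1\<close>, and at a root
  \<open>H\<^sub>n(r) = -c H\<^sub>n\<^sub>-\<^sub>1(r)\<close>, so that
  \<open>f'(r) = H\<^sub>n\<^sub>-\<^sub>1(r) (c^2 + 2n + 2cr)\<close> (\<open>pderiv_hermite_quasi_at_root\<close>). Both factors have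
  a computable product over the roots.

  The product of the \<open>H\<^sub>n\<^sub>-\<^sub>1(r)\<close> is a resultant. Exchanging the two polynomials turns it into
  the product of \<open>f\<close> over the roots of \<open>H\<^sub>n\<^sub>-\<^sub>1\<close>, where \<open>f\<close> equals \<open>-2(n-1) H\<^sub>n\<^sub>-\<^sub>2\<close>; hence it
  does not depend on \<open>c\<close>, and recursion gives a closed form (\<open>prod_hermite_at_roots\<close>).

  The product of the linear factors is, for nonzero \<open>c\<close>, the value of \<open>f\<close> at
  \<open>-(c^2 + 2n)/(2c)\<close> times \<open>(-c)\<^sup>n\<close>. Multiplying the three-term recurrence by powers of
  \<open>-c\<close> clears the denominators and produces this product as a polynomial in \<open>t = c^2\<close>
  (\<open>disc_factor\<close>), which makes evenness evident. The same recurrence gives the two top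
  coefficients of the polynomials involved; the \<open>t\<^sup>n\<close> terms cancel and \<open>t\<^sup>n\<^sup>-\<^sup>1\<close> is left with
  coefficient \<open>2\<close>, which is the statement about the degree (\<open>degree_disc_factor\<close>).
\<close>

section \<open>The discriminant as a product of derivative values\<close>

lemma pderiv_prod_linear_at_root:
  fixes r :: "nat \<Rightarrow> complex"
  assumes "k < n"
  shows "poly (pderiv (smult a (\<Prod>i<n. [:- r i, 1:]))) (r k) = a * (\<Prod>j\<in>{..<n} - {k}. r k - r j)"
proof -
  have "(\<Prod>i<n. [:- r i, 1:]) = [:- r k, 1:] * (\<Prod>j\<in>{..<n} - {k}. [:- r j, 1:])"
    using assms by (subst prod.remove[of _ k]) auto
  then show ?thesis
    by (simp add: pderiv_smult pderiv_mult pderiv_pCons poly_prod del: mult_pCons_left)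
qed

text \<open>
  Every unordered pair of indices contributes
  \<open>(r\<^sub>i - r\<^sub>j) (r\<^sub>j - r\<^sub>i) = -(r\<^sub>i - r\<^sub>j)^2\<close>. The number of pairs is kept as a sum: the same
  exponent arises in the product of the \<open>(-2k)\<^sup>k\<close> below, and the two signs then cancel.
\<close>

lemma prod_differences_eq_sign_squares:
  fixes r :: "nat \<Rightarrow> complex"
  shows "(\<Prod>k<n. \<Prod>j\<in>{..<n} - {k}. r k - r j) =
    (- 1) ^ (\<Sum>k<n. k) * (\<Prod>(i, j)\<in>{(i, j). i < j \<and> j < n}. (r i - r j)\<^sup>2)"
proof (induction n)
  case (Suc n)
  have fin: "finite {(i, j). i < j \<and> j < n}"
    by (rule finite_subset[of _ "{..<n} \<times> {..<n}"]) auto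
  have set: "{(i, j). i < j \<and> j < Suc n} = {(i, j). i < j \<and> j < n} \<union> (\<lambda>i. (i, n)) ` {..<n}"
    by (auto simp: less_Suc_eq)
  have squares: "(\<Prod>(i, j)\<in>{(i, j). i < j \<and> j < Suc n}. (r i - r j)\<^sup>2) =
      (\<Prod>(i, j)\<in>{(i, j). i < j \<and> j < n}. (r i - r j)\<^sup>2) * (\<Prod>i<n. (r i - r n)\<^sup>2)"
    unfolding set using fin
    by (subst prod.union_disjoint) (auto simp: prod.reindex inj_on_def)
  have row: "(\<Prod>j\<in>{..<Suc n} - {k}. r k - r j) = (\<Prod>j\<in>{..<n} - {k}. r k - r j) * (r k - r n)"
    if "k < n" for k
  proof -
    have "{..<Suc n} - {k} = insert n ({..<n} - {k})" using that by auto
    then show ?thesis by simp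
  qed
  have last: "(\<Prod>j\<in>{..<Suc n} - {n}. r n - r j) = (\<Prod>j<n. r n - r j)"
    by (rule prod.cong) auto
  have "(\<Prod>k<n. r k - r n) * (\<Prod>j<n. r n - r j) = (\<Prod>k<n. - 1 * (r k - r n)\<^sup>2)"
    unfolding prod.distrib[symmetric] by (rule prod.cong) (auto simp: power2_eq_square algebra_simps)
  also have "\<dots> = (- 1) ^ n * (\<Prod>k<n. (r k - r n)\<^sup>2)"
    by (subst prod.distrib) simp
  finally have new: "(\<Prod>k<n. r k - r n) * (\<Prod>j<n. r n - r j) = (- 1) ^ n * (\<Prod>k<n. (r k - r n)\<^sup>2)" .
  have "(\<Prod>k<Suc n. \<Prod>j\<in>{..<Suc n} - {k}. r k - r j) =
      (\<Prod>k<n. \<Prod>j\<in>{..<n} - {k}. r k - r j) * ((\<Prod>k<n. r k - r n) * (\<Prod>j<n. r n - r j))"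
    by (simp add: last row prod.distrib mult.assoc)
  then show ?case
    unfolding new Suc.IH squares by (simp add: power_add mult_ac)
qed simp

text \<open>
  Each of the \<open>n\<close> derivative values carries one factor \<open>a\<close>, while the discriminant carries
  \<open>a\<close> to the power \<open>2n - 2\<close>. The factor \<open>a\<^sup>2\<close> on the left avoids the exponent \<open>n - 2\<close>, which
  is negative for \<open>n = 1\<close>.
\<close>

lemma disc_eq_prod_pderiv:
  assumes "a \<noteq> 0" and f: "f = smult a (\<Prod>i<n. [:- r i, 1:])" and "n \<ge> 1"
  shows "a\<^sup>2 * disc f = (- 1) ^ (\<Sum>k<n. k) * a ^ n * (\<Prod>k<n. poly (pderiv f) (r k))"
proof -
  define S where "S = (\<Prod>(i, j)\<in>{(i, j). i < j \<and> j < n}. (r i - r j)\<^sup>2)"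
  have "f = smult a (\<Prod>x\<leftarrow>map r [0..<n]. [:- x, 1:])"
    unfolding f by (subst prod.list_conv_set_nth) (simp add: atLeast0LessThan)
  then have "disc f = a ^ (2 * n - 2) *
      (\<Prod>(i, j)\<in>{(i, j). i < j \<and> j < n}. (map r [0..<n] ! i - map r [0..<n] ! j)\<^sup>2)"
    using disc_eq[OF assms(1)] by (simp only: length_map length_upt diff_zero)
  also have "(\<Prod>(i, j)\<in>{(i, j). i < j \<and> j < n}. (map r [0..<n] ! i - map r [0..<n] ! j)\<^sup>2) = S"
    unfolding S_def by (rule prod.cong) auto
  finally have disc: "disc f = a ^ (2 * n - 2) * S" .
  have "2 * n - 2 + 2 = n + n" using \<open>n \<ge> 1\<close> by simp
  then have pow: "a\<^sup>2 * a ^ (2 * n - 2) = a ^ n * a ^ n"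
    by (metis power_add mult.commute)
  have "(\<Prod>k<n. poly (pderiv f) (r k)) = (\<Prod>k<n. a * (\<Prod>j\<in>{..<n} - {k}. r k - r j))"
    unfolding f by (rule prod.cong) (auto simp: pderiv_prod_linear_at_root)
  also have "\<dots> = a ^ n * ((- 1) ^ (\<Sum>k<n. k) * S)"
    by (simp add: prod.distrib prod_differences_eq_sign_squares S_def)
  finally have "(- 1) ^ (\<Sum>k<n. k) * a ^ n * (\<Prod>k<n. poly (pderiv f) (r k)) =
      ((- 1) ^ (\<Sum>k<n. k) * (- 1) ^ (\<Sum>k<n. k)) * (a ^ n * a ^ n) * S"
    by (simp only: mult_ac)
  also have "\<dots> = a\<^sup>2 * disc f"
    by (simp add: disc pow[symmetric] mult.assoc)
  finally show ?thesis ..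
qed

text \<open>
  This is the symmetry of the resultant: apart from leading coefficients, both sides are the
  product of all differences between a root of \<open>f\<close> and a root of \<open>g\<close>.
\<close>

lemma prod_values_at_roots_swap:
  fixes r s :: "nat \<Rightarrow> complex"
  assumes f: "f = smult a (\<Prod>i<n. [:- r i, 1:])" and g: "g = smult b (\<Prod>j<m. [:- s j, 1:])"
  shows "a ^ m * (\<Prod>i<n. poly g (r i)) = (- 1) ^ (n * m) * b ^ n * (\<Prod>j<m. poly f (s j))"
proof -
  have "(\<Prod>i<n. \<Prod>j<m. r i - s j) = (\<Prod>i<n. \<Prod>j<m. - 1 * (s j - r i))"
    by simp
  also have "\<dots> = (- 1) ^ (n * m) * (\<Prod>i<n. \<Prod>j<m. s j - r i)"
    unfolding prod.distrib by (simp add: power_mult mult.commute)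
  also have "(\<Prod>i<n. \<Prod>j<m. s j - r i) = (\<Prod>j<m. \<Prod>i<n. s j - r i)"
    by (rule prod.swap)
  finally have "(\<Prod>i<n. \<Prod>j<m. r i - s j) = (- 1) ^ (n * m) * (\<Prod>j<m. \<Prod>i<n. s j - r i)" .
  then show ?thesis
    unfolding f g by (simp add: poly_prod prod.distrib mult_ac)
qed

section \<open>Hermite polynomials and their values at the roots\<close>

lemma hermite_0: "hermite 0 = 1"
  by (simp add: hermite_def)

lemma degree_hermite: "degree (hermite n) = n"
  by (rule antisym[OF degree_le le_degree]) (simp_all add: coeff_hermite)

text \<open>
  Differentiating \<open>H\<^sub>n\<^sub>+\<^sub>1 = 2x H\<^sub>n - H\<^sub>n'\<close> gives \<open>2 H\<^sub>n\<close> plus the expression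
  \<open>2x H\<^sub>n' - H\<^sub>n''\<close>. By the induction hypothesis the latter is \<open>2n\<close> times
  \<open>2x H\<^sub>n\<^sub>-\<^sub>1 - H\<^sub>n\<^sub>-\<^sub>1'\<close>, that is, \<open>2n H\<^sub>n\<close>.
\<close>

lemma pderiv_hermite: "pderiv (hermite n) = smult (2 * of_nat n) (hermite (n - 1))"
proof (induction n)
  case (Suc n)
  show ?case
  proof (cases n)
    case 0
    then show ?thesis
      by (simp add: hermite_Suc hermite_0 pderiv_pCons)
  next
    case (Suc m)
    have "pderiv (hermite (Suc n)) =
        smult 2 (hermite n) + ([:0, 2:] * pderiv (hermite n) - pderiv (pderiv (hermite n)))"
      by (subst hermite_Suc) (simp add: pderiv_diff pderiv_mult pderiv_pCons pderiv_smult)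
    also have "[:0, 2:] * pderiv (hermite n) - pderiv (pderiv (hermite n)) =
        smult (2 * of_nat n) (hermite n)"
      unfolding Suc.IH by (simp add: Suc hermite_Suc[of m] pderiv_smult smult_diff_right mult.commute)
    finally show ?thesis
      by (simp add: smult_add_left distrib_left)
  qed
qed (simp add: hermite_0 pderiv_1)

lemma poly_pderiv_hermite:
  "poly (pderiv (hermite n)) x = 2 * of_nat n * poly (hermite (n - 1)) x"
  by (simp add: pderiv_hermite)

lemma poly_hermite_Suc:
  "poly (hermite (Suc n)) x =
    2 * x * poly (hermite n) x - 2 * of_nat n * poly (hermite (n - 1)) x"
  by (simp add: hermite_Suc poly_pderiv_hermite)

lemma hermite_quasi_zero: "hermite_quasi n 0 = hermite n"
  by (simp add: hermite_quasi_def)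

lemma degree_lead_coeff_hermite_quasi:
  assumes "n \<ge> 1"
  shows "degree (hermite_quasi n c) = n" "lead_coeff (hermite_quasi n c) = 2 ^ n"
proof -
  have "degree (smult c (hermite (n - 1))) < degree (hermite n)"
    using assms degree_smult_le[of c "hermite (n - 1)"] by (simp add: degree_hermite)
  then show "degree (hermite_quasi n c) = n" "lead_coeff (hermite_quasi n c) = 2 ^ n"
    unfolding hermite_quasi_def
    using degree_add_eq_left[of "smult c (hermite (n - 1))" "hermite n"]
      lead_coeff_add_le[of "smult c (hermite (n - 1))" "hermite n"]
    by (simp_all add: degree_hermite coeff_hermite coeff_eq_0)
qed

lemma hermite_quasi_roots:
  assumes "n \<ge> 1"
  obtains r where "hermite_quasi n c = smult (2 ^ n) (\<Prod>i<n. [:- r i, 1:])"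
  using complex_poly_decompose'[of "hermite_quasi n c"]
  by (metis degree_lead_coeff_hermite_quasi[OF assms])

text \<open>
  The induction has to range over all \<open>c\<close>: the roots of \<open>H\<^sub>n\<^sub>+\<^sub>1 + c H\<^sub>n\<close> are traded for those
  of \<open>H\<^sub>n\<close>, which is the case \<open>c = 0\<close> one index lower. The powers of the leading coefficients
  \<open>2\<^sup>n\<^sup>+\<^sup>1\<close> and \<open>2\<^sup>n\<close> in the exchange agree, and its sign is \<open>1\<close> because \<open>n (n + 1)\<close> is even.
  The factor for \<open>k = 0\<close> is \<open>0^0 = 1\<close>.
\<close>

lemma prod_hermite_at_roots:
  assumes "n \<ge> 1" and "hermite_quasi n c = smult (2 ^ n) (\<Prod>i<n. [:- r i, 1:])"
  shows "(\<Prod>i<n. poly (hermite (n - 1)) (r i)) = (\<Prod>k<n. (- 2 * of_nat k) ^ k)"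
  using assms
proof (induction n arbitrary: c r rule: nat_induct_at_least)
  case base
  then show ?case by (simp add: hermite_0)
next
  case (Suc n)
  obtain s where s: "hermite_quasi n 0 = smult (2 ^ n) (\<Prod>i<n. [:- s i, 1:])"
    using hermite_quasi_roots[OF Suc.hyps] .
  have root: "poly (hermite n) (s i) = 0" if "i < n" for i
    using that s by (auto simp: hermite_quasi_zero poly_prod)
  have at_root: "poly (hermite_quasi (Suc n) c) (s i) = - 2 * of_nat n * poly (hermite (n - 1)) (s i)"
    if "i < n" for i
    using root[OF that] by (simp add: hermite_quasi_def poly_hermite_Suc)
  have "(2 ^ Suc n) ^ n * (\<Prod>i<Suc n. poly (hermite n) (r i)) =
      (- 1) ^ (Suc n * n) * (2 ^ n) ^ Suc n * (\<Prod>i<n. poly (hermite_quasi (Suc n) c) (s i))"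
    by (rule prod_values_at_roots_swap[OF Suc.prems s[unfolded hermite_quasi_zero]])
  also have "(- 1) ^ (Suc n * n) = (1 :: complex)"
    by (rule neg_one_even_power) simp
  also have "(2 ^ n) ^ Suc n = ((2 ^ Suc n) ^ n :: complex)"
    by (simp only: power_mult[symmetric] mult.commute)
  finally have "(\<Prod>i<Suc n. poly (hermite n) (r i)) = (\<Prod>i<n. poly (hermite_quasi (Suc n) c) (s i))"
    by (simp del: power_Suc prod.lessThan_Suc)
  also have "\<dots> = (\<Prod>i<n. - 2 * of_nat n * poly (hermite (n - 1)) (s i))"
    by (rule prod.cong[OF refl]) (rule at_root, simp)
  also have "\<dots> = (- 2 * of_nat n) ^ n * (\<Prod>i<n. poly (hermite (n - 1)) (s i))"
    by (subst prod.distrib) simp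
  finally show ?case
    using Suc.IH[OF s] by simp
qed

lemma pderiv_hermite_quasi_at_root:
  assumes "n \<ge> 1" and "poly (hermite_quasi n c) x = 0"
  shows "poly (pderiv (hermite_quasi n c)) x = poly (hermite (n - 1)) x * (c\<^sup>2 + 2 * of_nat n + 2 * c * x)"
proof -
  obtain m where m: "n = Suc m" using assms(1) by (cases n) auto
  have "poly (hermite n) x = - c * poly (hermite m) x"
    using assms(2) by (simp add: hermite_quasi_def m add_eq_0_iff)
  moreover have "2 * of_nat m * poly (hermite (m - 1)) x = 2 * x * poly (hermite m) x - poly (hermite n) x"
    by (simp add: m poly_hermite_Suc)
  ultimately show ?thesis
    by (simp add: hermite_quasi_def pderiv_add pderiv_smult poly_pderiv_hermite m
        power2_eq_square algebra_simps)
qed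

section \<open>The even polynomial carrying the dependence on the parameter\<close>

text \<open>
  The argument \<open>x = -(c^2 + 2n)/(2c)\<close> satisfies \<open>(-c) (2x) = c^2 + 2n\<close>. Multiplying
  \<open>H\<^sub>m\<^sub>+\<^sub>2(x) = 2x H\<^sub>m\<^sub>+\<^sub>1(x) - 2(m+1) H\<^sub>m(x)\<close> by \<open>(-c)\<^sup>m\<^sup>+\<^sup>2\<close> therefore gives a recurrence for
  \<open>(-c)\<^sup>m H\<^sub>m(x)\<close> whose coefficients are polynomials in \<open>t = c^2\<close>. The first argument \<open>n\<close>
  enters only through \<open>x\<close> and stays fixed in the recursion.
\<close>

fun hermite_homog :: "nat \<Rightarrow> nat \<Rightarrow> complex poly" where
  "hermite_homog n 0 = 1"
| "hermite_homog n (Suc 0) = [:2 * of_nat n, 1:]"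
| "hermite_homog n (Suc (Suc m)) =
    [:2 * of_nat n, 1:] * hermite_homog n (Suc m) - [:0, 2 * of_nat (Suc m):] * hermite_homog n m"

lemma poly_hermite_homog:
  assumes "c \<noteq> 0"
  shows "poly (hermite_homog n m) (c\<^sup>2) =
    (- c) ^ m * poly (hermite m) (- ((c\<^sup>2 + 2 * of_nat n) / (2 * c)))"
proof (induction n m rule: hermite_homog.induct)
  case (3 n m)
  define x where "x = - ((c\<^sup>2 + 2 * of_nat n) / (2 * c))"
  have x: "c\<^sup>2 + 2 * of_nat n = (- c) * (2 * x)"
    using assms by (simp add: x_def field_simps)
  have "poly (hermite_homog n (Suc (Suc m))) (c\<^sup>2) =
     (c\<^sup>2 + 2 * of_nat n) * ((- c) ^ Suc m * poly (hermite (Suc m)) x) -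
     2 * of_nat (Suc m) * c\<^sup>2 * ((- c) ^ m * poly (hermite m) x)"
    using 3 unfolding x_def by (simp add: algebra_simps)
  also have "\<dots> = (- c) ^ Suc (Suc m) *
      (2 * x * poly (hermite (Suc m)) x - 2 * of_nat (Suc m) * poly (hermite m) x)"
    unfolding x by (simp add: power2_eq_square algebra_simps)
  finally show ?case
    by (simp only: poly_hermite_Suc[of "Suc m"] diff_Suc_1 x_def)
qed (use assms in \<open>simp_all add: hermite_0 hermite_Suc field_simps power2_eq_square\<close>)

lemma poly_hermite_homog_0: "poly (hermite_homog n m) 0 = (2 * of_nat n) ^ m"
  by (induction n m rule: hermite_homog.induct) simp_all

text \<open>
  The leading coefficient alone does not determine the degree of \<open>disc_factor\<close>, because the
  top terms cancel there; the next coefficient is needed. If \<open>e\<^sub>m\<close> denotes the coefficient of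
  \<open>t\<^sup>m\<^sup>-\<^sup>1\<close>, the recurrence reads \<open>e\<^sub>m\<^sub>+\<^sub>1 = e\<^sub>m + 2n - 2m\<close>.
\<close>

lemma hermite_homog_top_coeffs:
  "degree (hermite_homog n m) \<le> m \<and> coeff (hermite_homog n m) m = 1 \<and>
   (m \<ge> 1 \<longrightarrow> coeff (hermite_homog n m) (m - 1) = 2 * of_nat n * of_nat m - of_nat m * (of_nat m - 1))"
proof (induction n m rule: hermite_homog.induct)
  case (3 n m)
  have "degree (hermite_homog n (Suc (Suc m))) \<le> Suc (Suc m)"
  proof (rule degree_le, intro allI impI)
    fix i assume i: "Suc (Suc m) < i"
    then obtain j where j: "i = Suc j" "Suc m < j" by (cases i) auto
    show "coeff (hermite_homog n (Suc (Suc m))) i = 0"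
      using 3 i j by (auto simp: coeff_eq_0)
  qed
  moreover have "coeff (hermite_homog n (Suc m)) (Suc (Suc m)) = 0" "coeff (hermite_homog n m) (Suc m) = 0"
    using 3 by (auto intro!: coeff_eq_0)
  ultimately show ?case
    using 3 by (cases m) (auto simp: algebra_simps)
qed (simp_all add: degree_pCons_le)

text \<open>
  In terms of \<open>t = c^2\<close> this is \<open>(-c)\<^sup>n (H\<^sub>n(x) + c H\<^sub>n\<^sub>-\<^sub>1(x))\<close>: the surplus factor \<open>-c\<close> of the
  second term combines with \<open>c\<close> to \<open>-t\<close>.
\<close>

definition disc_factor :: "nat \<Rightarrow> complex poly" where
  "disc_factor n = hermite_homog n n - [:0, 1:] * hermite_homog n (n - 1)"

text \<open>
  The terms of degree \<open>n\<close> cancel, and the coefficient of \<open>t\<^sup>n\<^sup>-\<^sup>1\<close> is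
  \<open>e\<^sub>n - e\<^sub>n\<^sub>-\<^sub>1 = 2n - 2(n-1) = 2\<close> in the notation above.
\<close>

lemma degree_disc_factor:
  assumes "n \<ge> 1"
  shows "degree (disc_factor n) = n - 1"
proof -
  obtain m where m: "n = Suc m" using assms by (cases n) auto
  note top = hermite_homog_top_coeffs[of n n] hermite_homog_top_coeffs[of n m]
  have "coeff (disc_factor n) m = 2"
    using top m
    by (cases m) (auto simp: disc_factor_def algebra_simps simp del: hermite_homog.simps(3))
  moreover have "coeff (disc_factor n) i = 0" if i: "m < i" for i
  proof -
    obtain j where j: "i = Suc j" using i by (cases i) auto
    show ?thesis using top m i j
      by (cases "j = m") (auto simp: disc_factor_def coeff_eq_0 simp del: hermite_homog.simps(3))
  qed
  ultimately show ?thesis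
    using m by (intro antisym degree_le le_degree) auto
qed

lemma poly_disc_factor_0: "poly (disc_factor n) 0 = (2 * of_nat n) ^ n"
  by (simp add: disc_factor_def poly_hermite_homog_0)

lemma poly_disc_factor:
  assumes "n \<ge> 1" "c \<noteq> 0"
  shows "poly (disc_factor n) (c\<^sup>2) =
    (- c) ^ n * poly (hermite_quasi n c) (- ((c\<^sup>2 + 2 * of_nat n) / (2 * c)))"
proof -
  obtain m where m: "n = Suc m" using assms by (cases n) auto
  define x where "x = - ((c\<^sup>2 + 2 * of_nat n) / (2 * c))"
  have homog: "poly (hermite_homog n k) (c\<^sup>2) = (- c) ^ k * poly (hermite k) x" for k
    unfolding x_def by (rule poly_hermite_homog[OF assms(2)])
  have "poly (disc_factor n) (c\<^sup>2) =
      (- c) ^ Suc m * poly (hermite n) x - c\<^sup>2 * ((- c) ^ m * poly (hermite m) x)"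
    using homog[of n] homog[of m] by (simp add: disc_factor_def m)
  also have "\<dots> = (- c) ^ n * poly (hermite_quasi n c) x"
    by (simp add: hermite_quasi_def m power2_eq_square algebra_simps)
  finally show ?thesis
    unfolding x_def .
qed

text \<open>
  For nonzero \<open>c\<close> the factors are \<open>-2c (x - r\<^sub>i)\<close>, and the powers of \<open>2\<close> supply the leading
  coefficient of \<open>f\<close>. For \<open>c = 0\<close> the point \<open>x\<close> does not exist, but all factors are \<open>2n\<close>, so
  the constant coefficient of \<open>disc_factor\<close> decides.
\<close>

lemma prod_linear_factor_at_roots:
  assumes "n \<ge> 1" and f: "hermite_quasi n c = smult (2 ^ n) (\<Prod>i<n. [:- r i, 1:])"
  shows "(\<Prod>i<n. c\<^sup>2 + 2 * of_nat n + 2 * c * r i) = poly (disc_factor n) (c\<^sup>2)"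
proof (cases "c = 0")
  case True
  then show ?thesis using poly_disc_factor_0[of n] by simp
next
  case False
  define x where "x = - ((c\<^sup>2 + 2 * of_nat n) / (2 * c))"
  have "(\<Prod>i<n. c\<^sup>2 + 2 * of_nat n + 2 * c * r i) = (\<Prod>i<n. (- c) * 2 * (x - r i))"
    using False by (intro prod.cong) (auto simp: x_def field_simps)
  also have "\<dots> = (- c) ^ n * 2 ^ n * (\<Prod>i<n. x - r i)"
    by (simp only: prod.distrib prod_constant card_lessThan)
  also have "\<dots> = (- c) ^ n * poly (hermite_quasi n c) x"
    by (simp add: f poly_prod mult.assoc)
  finally show ?thesis
    using poly_disc_factor[OF assms(1) False] by (simp add: x_def)
qed

section \<open>The discriminant formula\<close>

lemma disc_hermite_quasi:
  assumes "n \<ge> 1"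
  shows "disc (hermite_quasi n c) =
    2 powi (int n * (3 * int n - 5) div 2) * (\<Prod>k = 1..n - 1. of_nat k ^ k) * poly (disc_factor n) (c\<^sup>2)"
proof -
  define T where "T = (\<Sum>k<n. k)"
  define K where "K = (\<Prod>k = 1..n - 1. of_nat k ^ k :: complex)"
  obtain r where f: "hermite_quasi n c = smult (2 ^ n) (\<Prod>i<n. [:- r i, 1:])"
    using hermite_quasi_roots[OF assms] .
  have root: "poly (hermite_quasi n c) (r i) = 0" if "i < n" for i
    using that by (auto simp: f poly_prod)
  \<comment> \<open>The factor for \<open>k = 0\<close> is \<open>0^0 = 1\<close>, so the index range may start at \<open>0\<close>.\<close>
  have "{..<n} = insert 0 {1..n - 1}" using assms by auto
  then have K: "(\<Prod>k<n. of_nat k ^ k) = K"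
    by (simp add: K_def)
  have "(\<Prod>k<n. (- 2 * of_nat k :: complex) ^ k) = (\<Prod>k<n. (- 1) ^ k * 2 ^ k * of_nat k ^ k)"
    by (simp add: power_mult_distrib[symmetric])
  also have "\<dots> = (- 1) ^ T * 2 ^ T * K"
    by (simp only: prod.distrib power_sum[symmetric] T_def K)
  finally have R: "(\<Prod>k<n. (- 2 * of_nat k :: complex) ^ k) = (- 1) ^ T * 2 ^ T * K" .
  have "(\<Prod>i<n. poly (pderiv (hermite_quasi n c)) (r i)) =
      (\<Prod>i<n. poly (hermite (n - 1)) (r i) * (c\<^sup>2 + 2 * of_nat n + 2 * c * r i))"
    using root pderiv_hermite_quasi_at_root[OF assms] by (intro prod.cong) auto
  also have "\<dots> = (- 1) ^ T * 2 ^ T * K * poly (disc_factor n) (c\<^sup>2)"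
    unfolding prod.distrib prod_hermite_at_roots[OF assms f] prod_linear_factor_at_roots[OF assms f] R ..
  finally have D: "(\<Prod>i<n. poly (pderiv (hermite_quasi n c)) (r i)) =
      (- 1) ^ T * 2 ^ T * K * poly (disc_factor n) (c\<^sup>2)" .
  have "(2 ^ n)\<^sup>2 * disc (hermite_quasi n c) =
      (- 1) ^ T * (2 ^ n) ^ n * ((- 1) ^ T * 2 ^ T * K * poly (disc_factor n) (c\<^sup>2))"
    using disc_eq_prod_pderiv[OF _ f assms] by (simp add: D T_def)
  also have "\<dots> = ((- 1) ^ T * (- 1) ^ T) * ((2 ^ n) ^ n * 2 ^ T) * K * poly (disc_factor n) (c\<^sup>2)"
    by (simp only: mult_ac)
  also have "(- 1) ^ T * (- 1) ^ T = (1 :: complex)"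
    by simp
  \<comment> \<open>With \<open>2T = n(n-1)\<close> the exponents satisfy
    \<open>n^2 + T - 2n = n(3n-5)/2\<close>; for \<open>n = 1\<close> this is \<open>-1\<close>.\<close>
  also have "(2 ^ n) ^ n * 2 ^ T = ((2 ^ n)\<^sup>2 * 2 powi (int n * (3 * int n - 5) div 2) :: complex)"
  proof -
    have "2 * T = n * (n - 1)"
      unfolding T_def using assms
      by (induction n rule: nat_induct_at_least) (auto simp: algebra_simps)
    then have "2 * int T = int n * (int n - 1)"
      using assms by (metis of_nat_diff of_nat_mult of_nat_numeral of_nat_1)
    then have "int n * (3 * int n - 5) = 2 * (int n * int n + int T - 2 * int n)"
      by (simp add: algebra_simps)
    then have e: "int n * (3 * int n - 5) div 2 = int (n * n + T) - int (n * 2)"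
      by simp
    show ?thesis
      unfolding e
      by (subst power_int_diff) (simp_all add: power_add power_mult[symmetric] del: of_nat_add of_nat_mult)
  qed
  finally show ?thesis
    unfolding K_def by simp
qed

theorem theorem4p10:
  fixes n :: nat
  assumes "n \<ge> 1"
  shows "\<exists>P D :: complex poly.
    (\<forall>c. c \<noteq> 0 \<longrightarrow>
       poly P c = (- c) ^ n * poly (hermite_quasi n c) (- ((c\<^sup>2 + 2 * of_nat n) / (2 * c)))) \<and>
    (\<forall>c. disc (hermite_quasi n c) =
       2 powi (int n * (3 * int n - 5) div 2) * (\<Prod>k = 1..n - 1. of_nat k ^ k) * poly P c) \<and>
    (\<forall>c. poly D c = disc (hermite_quasi n c)) \<and>
    (\<forall>c. poly D (- c) = poly D c) \<and>
    degree D = 2 * (n - 1)"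
proof -
  define P where "P = disc_factor n \<circ>\<^sub>p [:0, 0, 1:]"
  define a where "a = 2 powi (int n * (3 * int n - 5) div 2) * (\<Prod>k = 1..n - 1. of_nat k ^ k :: complex)"
  have P: "poly P c = poly (disc_factor n) (c\<^sup>2)" for c
    by (simp add: P_def poly_pcompose power2_eq_square)
  have "a \<noteq> 0" by (auto simp: a_def)
  moreover have "degree P = 2 * (n - 1)"
    by (simp add: P_def degree_pcompose degree_disc_factor[OF assms])
  ultimately show ?thesis
    using poly_disc_factor[OF assms] disc_hermite_quasi[OF assms]
    by (intro exI[of _ P] exI[of _ "smult a P"]) (auto simp: P a_def)
qed

end
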